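(* Let $n>1$ be an integer. The maximum size $\lambda_{3,1}(\mathbb{Z}_n)$ of a $(3,1)$-sum-free set in the cyclic group $\mathbb{Z}_n$ of order $n$ is given by $$\lambda_{3,1}(\mathbb{Z}_n)=\max_{d \mid n,\ d \not\equiv 2 \ (\mathrm{mod}\ 4)} \left\{ \left \lfloor \frac{d+2}{4} \right \rfloor \cdot \frac{n}{d} \right \},$$ where the maximum runs over all positive divisors $d$ of $n$ with $d\not\equiv 2 \pmod 4$; and this value equals $$\frac{p+1}{p} \cdot \frac{n}{4}$$ if $n$ is divisible by a prime congruent to $3$ modulo $4$ and $p$ is the smallest such prime, and equals $$\left \lfloor \frac{n}{4} \right \rfloor$$ otherwise.
   Context: For a positive integer $h$ and a subset $A$ of an (additively written) abelian group, $hA$ denotes the set of all sums of $h$ (not necessarily distinct) elements of $A$. A subset $A$ is called $(3,1)$-sum-free if $3A\cap A=\emptyset$. $\lambda_{3,1}(\mathbb{Z}_n)$ denotes the maximum size of a $(3,1)$-sum-free subset of $\mathbb{Z}_n$ (the empty set counts as $(3,1)$-sum-free). *)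

theory Defs
  imports Complex_Main "HOL-Algebra.FiniteProduct" "HOL-Algebra.Elementary_Groups" "HOL-Number_Theory.Cong"
    "HOL-Computational_Algebra.Primes"
begin

text \<open>
  Groups are written multiplicatively in \<open>HOL-Algebra\<close>, so the sum of \<open>h\<close> (not necessarily
  distinct) elements of \<open>A\<close> is the product \<open>finprod\<close> of a family of elements of \<open>A\<close> indexed by
  \<open>{..<h}\<close>. The notions below are meant for abelian \<open>G\<close>.
\<close>

definition h_fold_sumset :: "('a, 'b) monoid_scheme \<Rightarrow> nat \<Rightarrow> 'a set \<Rightarrow> 'a set" where
  "h_fold_sumset G h A = {finprod G a {..<h} | a. \<forall>i<h. a i \<in> A}"

definition sum_free_3_1 :: "('a, 'b) monoid_scheme \<Rightarrow> 'a set \<Rightarrow> bool" where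
  "sum_free_3_1 G A \<longleftrightarrow> A \<subseteq> carrier G \<and> h_fold_sumset G 3 A \<inter> A = {}"

text \<open>Only meaningful for finite \<open>G\<close>; the set of sizes is nonempty, as it contains
  \<open>card {} = 0\<close>.\<close>

definition lambda_3_1 :: "('a, 'b) monoid_scheme \<Rightarrow> nat" where
  "lambda_3_1 G = Max {card A | A. sum_free_3_1 G A}"

end

theory Submission
  imports Defs "HOL-Algebra.Multiplicative_Group"
begin

text \<open>
  Lower bound. If \<open>d\<close> divides \<open>n\<close> and \<open>d mod 4 \<noteq> 2\<close>, a suitable interval of length \<open>(d + 2) div 4\<close> is
  sum-free modulo \<open>d\<close> (lemma \<open>sum_free_interval\<close>), and so is its preimage under the reduction from
  modulus \<open>n\<close> to modulus \<open>d\<close>, which is \<open>n div d\<close> times as large.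

  Upper bound. Let \<open>A\<close> be sum-free and nonempty. The sumset \<open>A + A\<close> and the difference set \<open>A - A\<close> are
  disjoint, so if both had at least \<open>2 * card A - 1\<close> elements, then \<open>card A \<le> (n + 2) div 4\<close> would follow.
  Whether sumsets with \<open>A\<close> are that large is decided by an isoperimetric argument
  (\<open>isoperimetric_alternative\<close>): either \<open>X + A\<close> has at least \<open>card X + card A - 1\<close> elements for
  all nonempty \<open>X\<close> with \<open>X + A\<close> not the whole group, or this fails already for some subgroup \<open>X = H\<close>.

  In the second case \<open>A\<close> nearly fills the cosets of \<open>H\<close> that it meets, so the relation
  \<open>a + b + c = e\<close>, which has no solutions in \<open>A\<close>, has none among these cosets either, except in a
  situation where \<open>A\<close> has at most \<open>n div 4\<close> elements (\<open>sum_free_image_or_small\<close>). Thus \<open>A\<close> may be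
  replaced by its image in the quotient by \<open>H\<close>, and the bound follows by induction on \<open>n\<close>.

  In the first case the bound \<open>(n + 2) div 4\<close> is the term of the divisor \<open>n\<close> or \<open>n div 2\<close> in the
  maximum, except when \<open>n mod 8 = 2\<close>: then the term of \<open>n div 2\<close> falls short of it by one, and the
  bound has to be improved. A set with \<open>4 * card A = n + 2\<close> would make \<open>A + A\<close>
  and \<open>A - A\<close> complementary, which forces \<open>A\<close> to be symmetric under \<open>x \<mapsto> n div 2 - x\<close>.
  This reflection has no fixed point, so \<open>card A\<close> would be even, whereas \<open>(n + 2) div 4\<close> is odd
  (\<open>sum_free_expanding_not_extremal\<close>).

  The closed form is obtained by comparing the terms of the maximum: four times the term of \<open>d\<close> is
  at most \<open>n\<close> if \<open>d mod 4\<close> is \<open>0\<close> or \<open>1\<close>, and is \<open>n + n div d\<close> if \<open>d mod 4 = 3\<close>.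
\<close>

section \<open>Sumsets and isoperimetry in finite abelian groups\<close>

locale finite_comm_group = comm_group +
  assumes finite_carrier [simp]: "finite (carrier G)"

lemma (in group) in_set_mult_iff:
  "z \<in> A <#> B \<longleftrightarrow> (\<exists>a\<in>A. \<exists>b\<in>B. z = a \<otimes> b)"
  by (auto simp: set_mult_def)

context finite_comm_group
begin

lemma finite_sub [intro]: "X \<subseteq> carrier G \<Longrightarrow> finite X"
  using finite_carrier finite_subset by blast

lemma card_sub: "X \<subseteq> carrier G \<Longrightarrow> card X \<le> card (carrier G)"
  by (simp add: card_mono)

lemma card_translate:
  assumes "x \<in> carrier G" "X \<subseteq> carrier G"
  shows "card ((\<otimes>) x ` X) = card X"
  by (rule card_image) (use assms in \<open>auto simp: inj_on_def subset_iff\<close>)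

lemma card_inverses:
  assumes "X \<subseteq> carrier G"
  shows "card (m_inv G ` X) = card X"
  by (rule card_image) (use assms inv_inj in \<open>auto simp: inj_on_def subset_iff\<close>)

lemma translate_set_mult:
  assumes "x \<in> carrier G" "X \<subseteq> carrier G" "S \<subseteq> carrier G"
  shows "(\<otimes>) x ` X <#> S = (\<otimes>) x ` (X <#> S)"
proof -
  have "x \<otimes> a \<otimes> s = x \<otimes> (a \<otimes> s)" if "a \<in> X" "s \<in> S" for a s
    using that assms by (intro m_assoc) auto
  then show ?thesis unfolding set_mult_def by auto
qed

text \<open>
  If \<open>inv y \<otimes> s = inv x\<close> then \<open>y = x \<otimes> s\<close>, so passing from \<open>X\<close> to the inverse of the complement of
  \<open>X <#> S\<close> cannot reach the inverse of \<open>X\<close>. Hence the dual set has a boundary that is at most the boundary of \<open>X\<close>.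
\<close>

lemma dual_set_mult:
  assumes X: "X \<subseteq> carrier G" and S: "S \<subseteq> carrier G"
  shows "m_inv G ` (carrier G - (X <#> S)) <#> S \<subseteq> carrier G - m_inv G ` X"
proof
  fix z assume "z \<in> m_inv G ` (carrier G - (X <#> S)) <#> S"
  then obtain y s where y: "y \<in> carrier G" "y \<notin> X <#> S" and s: "s \<in> S" and z: "z = inv y \<otimes> s"
    by (auto simp: in_set_mult_iff)
  have sG: "s \<in> carrier G" using s S by auto
  have "z \<noteq> inv x" if x: "x \<in> X" for x
  proof
    assume e: "z = inv x"
    have xG: "x \<in> carrier G" using x X by auto
    have "x \<otimes> s = x \<otimes> (y \<otimes> z)" using z y sG by (simp add: m_assoc[symmetric])
    also have "\<dots> = y \<otimes> (x \<otimes> inv x)" using e xG y by (simp only: m_lcomm inv_closed)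
    also have "\<dots> = y" using xG y by simp
    finally show False using y x s by (auto simp: in_set_mult_iff)
  qed
  then show "z \<in> carrier G - m_inv G ` X" using z y sG by auto
qed

text \<open>
  This is Mann's theorem in Hamidoune's isoperimetric form. Call \<open>card (X <#> S) - card X\<close> the boundary of
  \<open>X\<close>, and let an atom be a set of least cardinality among those nonempty \<open>X\<close> with \<open>X <#> S \<noteq> carrier G\<close>
  that have least boundary. Union and intersection of two sets are submodular for the boundary; if two
  atoms met without being equal, their intersection would have boundary above the minimum, hence their
  union below it. Duality provides the room that keeps the sumset of the union away from the
  whole group. So distinct atoms are disjoint. As translates of atoms are atoms, the atom that
  contains \<open>\<one>\<close> is carried to itself by the inverse of each of its elements, so it is a subgroup. If the
  least boundary is below \<open>card S - 1\<close>, the boundary of \<open>{\<one>}\<close>, this subgroup witnesses it.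
\<close>

theorem isoperimetric_alternative:
  assumes S: "S \<subseteq> carrier G"
  shows "(\<forall>X. X \<subseteq> carrier G \<and> X \<noteq> {} \<and> X <#> S \<noteq> carrier G \<longrightarrow>
             card X + card S \<le> card (X <#> S) + 1)
    \<or> (\<exists>H. subgroup H G \<and> H <#> S \<noteq> carrier G \<and> card (H <#> S) + 1 < card H + card S)"
proof (rule disjCI)
  assume "\<not> (\<exists>H. subgroup H G \<and> H <#> S \<noteq> carrier G \<and> card (H <#> S) + 1 < card H + card S)"
  then have noH: "card H + card S \<le> card (H <#> S) + 1"
    if "subgroup H G" "H <#> S \<noteq> carrier G" for H using that by force
  show "\<forall>X. X \<subseteq> carrier G \<and> X \<noteq> {} \<and> X <#> S \<noteq> carrier G \<longrightarrow>
             card X + card S \<le> card (X <#> S) + 1"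
  proof (intro allI impI)
    fix X0 assume X0: "X0 \<subseteq> carrier G \<and> X0 \<noteq> {} \<and> X0 <#> S \<noteq> carrier G"
    define F where "F = {X. X \<subseteq> carrier G \<and> X \<noteq> {} \<and> X <#> S \<noteq> carrier G}"
    define b where "b X = int (card (X <#> S)) - int (card X)" for X
    have NS: "X <#> S \<subseteq> carrier G" if "X \<subseteq> carrier G" for X
      using that S by (simp add: set_mult_closed)
    have X0F: "X0 \<in> F" using X0 by (simp add: F_def)
    have "finite F" by (rule finite_subset[of _ "Pow (carrier G)"]) (auto simp: F_def)
    define \<kappa> where "\<kappa> = Min (b ` F)"
    have \<kappa>_le: "\<kappa> \<le> b X" if "X \<in> F" for X
      using that \<open>finite F\<close> by (simp add: \<kappa>_def)
    have "\<kappa> \<in> b ` F" unfolding \<kappa>_def using \<open>finite F\<close> X0F by (intro Min_in) auto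
    then obtain X1 where X1: "X1 \<in> F \<and> b X1 = \<kappa>" by auto
    define M where "M = arg_min card (\<lambda>X. X \<in> F \<and> b X = \<kappa>)"
    have M: "M \<in> F" "b M = \<kappa>" using arg_min_natI[of "\<lambda>X. X \<in> F \<and> b X = \<kappa>", OF X1, of card]
      by (auto simp: M_def)
    have M_le: "card M \<le> card X" if "X \<in> F" "b X = \<kappa>" for X
      using arg_min_nat_le[of "\<lambda>X. X \<in> F \<and> b X = \<kappa>" X card] that by (auto simp: M_def)
    define atom where "atom X \<longleftrightarrow> X \<in> F \<and> b X = \<kappa> \<and> card X = card M" for X
    \<comment> \<open>The dual of an atom is also a set of least boundary, hence at least as large as the atom.\<close>
    have dual: "2 * int (card M) + \<kappa> \<le> int (card (carrier G))"
    proof -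
      define M' where "M' = m_inv G ` (carrier G - (M <#> S))"
      have MG: "M \<subseteq> carrier G" and Mne: "M \<noteq> {}" using M by (auto simp: F_def)
      have cM': "card M' = card (carrier G) - card (M <#> S)"
        unfolding M'_def using NS[OF MG]
        by (subst card_inverses) (auto simp: card_Diff_subset finite_sub)
      have M'G: "M' \<subseteq> carrier G" by (auto simp: M'_def)
      have sub: "M' <#> S \<subseteq> carrier G - m_inv G ` M"
        unfolding M'_def by (rule dual_set_mult[OF MG S])
      have "m_inv G ` M \<subseteq> carrier G" using MG by auto
      then have "card (carrier G - m_inv G ` M) = card (carrier G) - card M"
        by (simp add: card_Diff_subset finite_sub card_inverses[OF MG])
      moreover have "card (M' <#> S) \<le> card (carrier G - m_inv G ` M)"
        by (intro card_mono sub) auto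
      ultimately have c2: "card (M' <#> S) \<le> card (carrier G) - card M" by simp
      have "carrier G - (M <#> S) \<noteq> {}" using M NS[OF MG] by (auto simp: F_def)
      then have "M' \<noteq> {}" by (simp add: M'_def)
      moreover have "M' <#> S \<noteq> carrier G" using sub Mne MG by blast
      ultimately have M'F: "M' \<in> F" using M'G by (simp add: F_def)
      have "b M' \<le> b M" using c2 cM' card_sub[OF MG] card_sub[OF NS[OF MG]]
        by (simp add: b_def)
      with M \<kappa>_le[OF M'F] have "b M' = \<kappa>" by simp
      from M_le[OF M'F this] M(2) cM' card_sub[OF NS[OF MG]] show ?thesis
        by (simp add: b_def)
    qed
    have atoms_disjoint: "X = Y" if X: "atom X" and Y: "atom Y" and ne: "X \<inter> Y \<noteq> {}" for X Y
    proof (rule ccontr)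
      assume "X \<noteq> Y"
      have XG: "X \<subseteq> carrier G" and YG: "Y \<subseteq> carrier G"
        and XF: "X \<in> F" and YF: "Y \<in> F" using X Y by (auto simp: atom_def F_def)
      have fX: "finite X" "finite Y" using XG YG by auto
      have "X \<inter> Y \<noteq> X"
      proof
        assume "X \<inter> Y = X"
        then have "X \<subseteq> Y" by auto
        then show False using card_subset_eq[of Y X] X Y fX \<open>X \<noteq> Y\<close> by (auto simp: atom_def)
      qed
      then have less: "card (X \<inter> Y) < card M"
        using X psubset_card_mono[of X "X \<inter> Y"] fX by (auto simp: atom_def)
      have IS: "(X \<inter> Y) <#> S \<subseteq> (X <#> S) \<inter> (Y <#> S)" by (auto simp: set_mult_def)
      have US: "(X \<union> Y) <#> S = (X <#> S) \<union> (Y <#> S)" by (auto simp: set_mult_def)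
      have fin: "finite (X <#> S)" "finite (Y <#> S)" using NS XG YG by auto
      have IF: "X \<inter> Y \<in> F" using XF YF IS ne NS[OF XG] by (auto simp: F_def)
      have bI: "b (X \<inter> Y) > \<kappa>" using \<kappa>_le[OF IF] M_le[OF IF] less by force
      have sub1: "int (card ((X \<union> Y) <#> S)) + int (card ((X \<inter> Y) <#> S))
          \<le> int (card (X <#> S)) + int (card (Y <#> S))"
        using card_Un_Int[OF fin] card_mono[OF _ IS] fin unfolding US by simp
      have sub2: "int (card (X \<union> Y)) + int (card (X \<inter> Y)) = 2 * int (card M)"
        using card_Un_Int[OF fX] X Y by (simp add: atom_def)
      have bXY: "int (card (X <#> S)) = \<kappa> + int (card M)" "int (card (Y <#> S)) = \<kappa> + int (card M)"
        using X Y by (auto simp: atom_def b_def)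
      have "card ((X \<union> Y) <#> S) < card (carrier G)"
        using sub1 bXY bI dual unfolding b_def by linarith
      then have "X \<union> Y \<in> F" using XG YG ne by (auto simp: F_def)
      from \<kappa>_le[OF this] show False using sub1 sub2 bXY bI unfolding b_def by linarith
    qed
    have atom_translate: "atom ((\<otimes>) x ` X)" if x: "x \<in> carrier G" and X: "atom X" for x X
    proof -
      have XG: "X \<subseteq> carrier G" and XF: "X \<in> F" using X by (auto simp: atom_def F_def)
      have c1: "card ((\<otimes>) x ` X) = card X" by (rule card_translate[OF x XG])
      have c2: "card ((\<otimes>) x ` X <#> S) = card (X <#> S)"
        unfolding translate_set_mult[OF x XG S] by (rule card_translate[OF x NS[OF XG]])
      have "card (X <#> S) < card (carrier G)"
        using XF NS[OF XG] by (intro psubset_card_mono) (auto simp: F_def)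
      then have "(\<otimes>) x ` X \<in> F" using XF x c2 by (auto simp: F_def)
      then show ?thesis using X c1 c2 by (auto simp: atom_def b_def)
    qed
    \<comment> \<open>The translate of an atom that contains \<open>\<one>\<close> is the required subgroup.\<close>
    from M have MG: "M \<subseteq> carrier G" and "M \<noteq> {}" by (auto simp: F_def)
    then obtain m where m: "m \<in> M" "m \<in> carrier G" by auto
    define H where "H = (\<otimes>) (inv m) ` M"
    have H: "atom H" unfolding H_def using M m by (intro atom_translate) (auto simp: atom_def)
    then have HG: "H \<subseteq> carrier G" and HF: "H \<in> F" by (auto simp: atom_def F_def)
    have oneH: "\<one> \<in> H" unfolding H_def using m by force
    have Htr: "(\<otimes>) (inv h) ` H = H" if h: "h \<in> H" for h
    proof (rule atoms_disjoint)
      have hG: "h \<in> carrier G" using h HG by auto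
      then show "atom ((\<otimes>) (inv h) ` H)" using H by (intro atom_translate) auto
      have "\<one> = inv h \<otimes> h" using hG by simp
      then have "\<one> \<in> (\<otimes>) (inv h) ` H" using h by blast
      then show "(\<otimes>) (inv h) ` H \<inter> H \<noteq> {}" using oneH by blast
    qed (rule H)
    have inv_H: "inv h \<in> H" if "h \<in> H" for h
    proof -
      have "inv h \<otimes> \<one> \<in> H" using Htr[OF that] oneH by blast
      then show ?thesis using that HG by auto
    qed
    have "subgroup H G"
    proof (rule subgroupI)
      fix a c assume "a \<in> H" "c \<in> H"
      then have "inv (inv a) \<otimes> c \<in> H" using Htr[OF inv_H[of a]] by blast
      then show "a \<otimes> c \<in> H" using \<open>a \<in> H\<close> HG by auto
    qed (use HG oneH inv_H in auto)
    with HF have "card H + card S \<le> card (H <#> S) + 1" by (intro noH) (auto simp: F_def)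
    moreover have "b H \<le> b X0" using H \<kappa>_le[OF X0F] by (simp add: atom_def)
    ultimately show "card X0 + card S \<le> card (X0 <#> S) + 1" by (simp add: b_def)
  qed
qed

end

section \<open>Counting\<close>

lemma even_card_fixpoint_free_involution:
  assumes "finite A"
    and "\<And>x. x \<in> A \<Longrightarrow> f x \<in> A" "\<And>x. x \<in> A \<Longrightarrow> f (f x) = x" "\<And>x. x \<in> A \<Longrightarrow> f x \<noteq> x"
  shows "even (card A)"
  using assms
proof (induction A rule: finite_psubset_induct)
  case (psubset A)
  show ?case
  proof (cases "A = {}")
    case False
    then obtain x where x: "x \<in> A" by blast
    let ?B = "A - {x, f x}"
    have "even (card ?B)"
    proof (rule psubset.IH)
      show "?B \<subset> A" using x by blast
      fix y assume y: "y \<in> ?B"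
      then have yA: "y \<in> A" by simp
      have "f y \<noteq> x" using psubset.prems(2)[OF yA] y by auto
      moreover have "f y \<noteq> f x" using psubset.prems(2)[OF yA] psubset.prems(2)[OF x] y by auto
      ultimately show "f y \<in> ?B" using psubset.prems(1)[OF yA] by simp
      show "f (f y) = y" "f y \<noteq> y" using psubset.prems(2,3)[OF yA] .
    qed
    moreover have "card A = card ?B + card {x, f x}"
      using card_Int_Diff[OF psubset.hyps(1), of "{x, f x}"] x psubset.prems(1)[OF x]
      by (simp add: Int_absorb1)
    moreover have "card {x, f x} = 2" using psubset.prems(3)[OF x] by simp
    ultimately show ?thesis by simp
  qed simp
qed

lemma disjoint_card_le:
  assumes "finite C" "U \<subseteq> C" "V \<subseteq> C" "U \<inter> V = {}"
  shows "card U + card V \<le> card C"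
proof -
  have "card U + card V = card (U \<union> V)"
    using assms by (intro card_Un_disjoint[symmetric]) (auto intro: finite_subset)
  also have "\<dots> \<le> card C" using assms by (intro card_mono) auto
  finally show ?thesis .
qed

section \<open>Sum-free sets that nearly fill cosets\<close>

lemma (in comm_group) sum_free_3_1_iff:
  "sum_free_3_1 G A \<longleftrightarrow> A \<subseteq> carrier G \<and> (\<forall>a\<in>A. \<forall>b\<in>A. \<forall>c\<in>A. a \<otimes> b \<otimes> c \<notin> A)"
proof (cases "A \<subseteq> carrier G")
  case True
  have fp: "finprod G f {..<3} = f 0 \<otimes> f 1 \<otimes> f 2" if f: "\<forall>i<3. f i \<in> A" for f :: "nat \<Rightarrow> 'a"
  proof -
    have f': "f 0 \<in> carrier G" "f 1 \<in> carrier G" "f 2 \<in> carrier G" using f True by auto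
    have "{..<3::nat} = {0, 1, 2}" by auto
    then have "finprod G f {..<3} = f 0 \<otimes> (f 1 \<otimes> f 2)" using f' by simp
    then show ?thesis using f' by (simp add: m_assoc)
  qed
  have "h_fold_sumset G 3 A = {a \<otimes> b \<otimes> c |a b c. a \<in> A \<and> b \<in> A \<and> c \<in> A}" (is "_ = ?R")
  proof
    show "h_fold_sumset G 3 A \<subseteq> ?R"
    proof
      fix x assume "x \<in> h_fold_sumset G 3 A"
      then obtain f :: "nat \<Rightarrow> 'a" where f: "x = finprod G f {..<3}" "\<forall>i<3. f i \<in> A"
        by (auto simp: h_fold_sumset_def)
      moreover have "f 0 \<in> A" "f 1 \<in> A" "f 2 \<in> A" using f(2) by simp_all
      ultimately show "x \<in> ?R" using fp[OF f(2)] by blast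
    qed
    show "?R \<subseteq> h_fold_sumset G 3 A"
    proof
      fix x assume "x \<in> ?R"
      then obtain a b c where abc: "x = a \<otimes> b \<otimes> c" "a \<in> A" "b \<in> A" "c \<in> A" by auto
      define f where "f i = (if i = (0::nat) then a else if i = 1 then b else c)" for i
      have "\<forall>i<3. f i \<in> A" using abc by (simp add: f_def)
      then have "finprod G f {..<3} = f 0 \<otimes> f 1 \<otimes> f 2" by (rule fp)
      then have "finprod G f {..<3} = x" using abc by (simp add: f_def)
      with \<open>\<forall>i<3. f i \<in> A\<close> show "x \<in> h_fold_sumset G 3 A" by (auto simp: h_fold_sumset_def)
    qed
  qed
  then show ?thesis using True by (simp add: sum_free_3_1_def disjoint_iff) metis
qed (simp add: sum_free_3_1_def)

context finite_comm_group
begin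

lemma card_fiber:
  assumes Q: "comm_group Q" and hom: "\<phi> \<in> hom G Q" and a: "a \<in> carrier G"
  shows "card {x \<in> carrier G. \<phi> x = \<phi> a} = card (kernel G Q \<phi>)"
    and "x \<in> carrier G \<Longrightarrow> \<phi> x = \<phi> a \<Longrightarrow> x \<otimes> inv a \<in> kernel G Q \<phi>"
proof -
  interpret Q: comm_group Q by (rule Q)
  interpret group_hom G Q \<phi> by unfold_locales (rule hom)
  have ker: "x \<otimes> inv a \<in> kernel G Q \<phi>" if "x \<in> carrier G" "\<phi> x = \<phi> a" for x
    using that a by (simp add: kernel_def)
  show "x \<in> carrier G \<Longrightarrow> \<phi> x = \<phi> a \<Longrightarrow> x \<otimes> inv a \<in> kernel G Q \<phi>" by (rule ker)
  have "{x \<in> carrier G. \<phi> x = \<phi> a} = (\<otimes>) a ` kernel G Q \<phi>"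
  proof (intro equalityI subsetI)
    fix x assume x: "x \<in> {x \<in> carrier G. \<phi> x = \<phi> a}"
    have "x = a \<otimes> (x \<otimes> inv a)" using x a by (simp add: m_lcomm[of a x])
    moreover have "x \<otimes> inv a \<in> kernel G Q \<phi>" using x ker by simp
    ultimately show "x \<in> (\<otimes>) a ` kernel G Q \<phi>" by (rule image_eqI)
  qed (use a in \<open>auto simp: kernel_def\<close>)
  then show "card {x \<in> carrier G. \<phi> x = \<phi> a} = card (kernel G Q \<phi>)"
    using card_translate[OF a, of "kernel G Q \<phi>"] by (simp add: kernel_def)
qed

text \<open>
  The hypothesis \<open>small\<close> says that \<open>A\<close> misses fewer than \<open>card H - 1\<close> elements of the cosets of the kernel
  \<open>H\<close> that it meets, so any two distinct such cosets together contain more than \<open>card H\<close> elements of \<open>A\<close>.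
  Suppose, with both groups written additively, that the cosets of \<open>a\<close>, \<open>b\<close>, \<open>c\<close>, \<open>e\<close> satisfy \<open>a + b + c = e\<close> in the quotient. Translating the
  part of \<open>A\<close> in the first coset by \<open>b + c\<close> moves it into the last coset, where it must avoid \<open>A\<close>; so
  those two parts have at most \<open>card H\<close> elements together, and the two cosets coincide. By symmetry all
  four coincide, and \<open>2 e = 0\<close> in the quotient. Then \<open>e + e + t = t\<close> is a relation for every coset \<open>t\<close>
  that \<open>A\<close> meets, which gives \<open>t = e\<close>: the set \<open>A\<close> lies in one coset and fills at most half of it.
\<close>

lemma sum_free_image_or_small:
  assumes Q: "comm_group Q" and hom: "\<phi> \<in> hom G Q" and sf: "sum_free_3_1 G A"
    and small: "card (kernel G Q \<phi> <#> A) + 1 < card (kernel G Q \<phi>) + card A"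
  shows "sum_free_3_1 Q (\<phi> ` A) \<or> 2 * card A \<le> card (kernel G Q \<phi>)"
proof -
  interpret Q: comm_group Q by (rule Q)
  interpret group_hom G Q \<phi> by unfold_locales (rule hom)
  define H where "H = kernel G Q \<phi>"
  define fib where "fib a = {x \<in> carrier G. \<phi> x = \<phi> a}" for a
  have A: "A \<subseteq> carrier G" and rel: "\<And>a b c. a \<in> A \<Longrightarrow> b \<in> A \<Longrightarrow> c \<in> A \<Longrightarrow> a \<otimes> b \<otimes> c \<notin> A"
    using sf by (auto simp: sum_free_3_1_iff)
  have inG: "x \<in> carrier G" if "x \<in> A" for x using that A by auto
  have HG: "H \<subseteq> carrier G" by (auto simp: H_def kernel_def)
  have card_fib: "card (fib a) = card H" if "a \<in> A" for a
    unfolding fib_def H_def by (rule card_fiber[OF Q hom inG[OF that]])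
  have fin: "finite (fib a)" for a by (simp add: fib_def)
  have fib_sub: "fib a \<subseteq> H <#> A" if "a \<in> A" for a
  proof
    fix x assume x: "x \<in> fib a"
    then have xG: "x \<in> carrier G" and "x \<otimes> inv a \<in> H"
      using card_fiber(2)[OF Q hom inG[OF that]] by (auto simp: fib_def H_def)
    moreover have "x = x \<otimes> inv a \<otimes> a" using xG inG[OF that] by (simp add: m_assoc)
    ultimately show "x \<in> H <#> A" using that by (auto simp: in_set_mult_iff)
  qed
  have finHA: "finite (H <#> A)" using HG A by (intro finite_sub set_mult_closed)
  have AHA: "A \<subseteq> H <#> A" using fib_sub inG by (auto simp: fib_def)
  have large: "card H < card (A \<inter> fib a) + card (A \<inter> fib b)"
    if ab: "a \<in> A" "b \<in> A" "\<phi> a \<noteq> \<phi> b" for a b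
  proof -
    have "fib a \<inter> fib b = {}" using ab by (auto simp: fib_def)
    then have "(fib a - A) \<inter> (fib b - A) = {}" by blast
    moreover have "fib a - A \<subseteq> (H <#> A) - A" "fib b - A \<subseteq> (H <#> A) - A"
      using fib_sub[OF ab(1)] fib_sub[OF ab(2)] by blast+
    ultimately have "card (fib a - A) + card (fib b - A) \<le> card ((H <#> A) - A)"
      using finHA by (intro disjoint_card_le) simp_all
    also have "card ((H <#> A) - A) = card (H <#> A) - card A"
      using AHA A by (intro card_Diff_subset) auto
    finally have le: "card (fib a - A) + card (fib b - A) \<le> card (H <#> A) - card A" .
    have diff: "card (fib x - A) + card (A \<inter> fib x) = card H" if "x \<in> A" for x
      using card_Int_Diff[OF fin, of x A] card_fib[OF that] by (simp add: Int_commute)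
    have "card A \<le> card (H <#> A)" using AHA finHA by (rule card_mono[rotated])
    then show ?thesis using le diff[OF ab(1)] diff[OF ab(2)] small unfolding H_def[symmetric]
      by linarith
  qed
  have bound: "card (A \<inter> fib a) + card (A \<inter> fib e) \<le> card H"
    if abce: "a \<in> A" "b \<in> A" "c \<in> A" "e \<in> A"
      and eq: "\<phi> a \<otimes>\<^bsub>Q\<^esub> \<phi> b \<otimes>\<^bsub>Q\<^esub> \<phi> c = \<phi> e" for a b c e
  proof -
    have G: "a \<in> carrier G" "b \<in> carrier G" "c \<in> carrier G" "e \<in> carrier G" using abce inG by auto
    let ?U = "(\<otimes>) (b \<otimes> c) ` (A \<inter> fib a)"
    have U: "x \<in> ?U \<Longrightarrow> x \<in> fib e \<and> x \<notin> A" for x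
    proof -
      assume "x \<in> ?U"
      then obtain y where y: "y \<in> A" "y \<in> fib a" "x = b \<otimes> c \<otimes> y" by auto
      then have "x = y \<otimes> b \<otimes> c" using G inG by (simp add: m_ac)
      moreover have "\<phi> (y \<otimes> b \<otimes> c) = \<phi> e" using y(2) G eq by (simp add: fib_def)
      ultimately show ?thesis using y rel abce G inG by (auto simp: fib_def)
    qed
    have "card ?U + card (A \<inter> fib e) \<le> card (fib e)"
      by (rule disjoint_card_le[OF fin]) (use U in auto)
    moreover have "card ?U = card (A \<inter> fib a)" using G A by (intro card_translate) auto
    ultimately show ?thesis using card_fib abce by simp
  qed
  have same: "\<phi> a = \<phi> e"
    if "a \<in> A" "b \<in> A" "c \<in> A" "e \<in> A" "\<phi> a \<otimes>\<^bsub>Q\<^esub> \<phi> b \<otimes>\<^bsub>Q\<^esub> \<phi> c = \<phi> e" for a b c e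
    using bound[OF that] large[of a e] that by linarith
  have "2 * card A \<le> card (kernel G Q \<phi>)" if not_sf: "\<not> sum_free_3_1 Q (\<phi> ` A)"
  proof -
    note not_sf
    moreover have "\<phi> ` A \<subseteq> carrier Q" using inG by auto
    ultimately obtain a b c e where abce: "a \<in> A" "b \<in> A" "c \<in> A" "e \<in> A"
      and eq: "\<phi> a \<otimes>\<^bsub>Q\<^esub> \<phi> b \<otimes>\<^bsub>Q\<^esub> \<phi> c = \<phi> e"
      by (fastforce simp: Q.sum_free_3_1_iff)
    have "\<phi> b \<otimes>\<^bsub>Q\<^esub> \<phi> a \<otimes>\<^bsub>Q\<^esub> \<phi> c = \<phi> e" "\<phi> c \<otimes>\<^bsub>Q\<^esub> \<phi> a \<otimes>\<^bsub>Q\<^esub> \<phi> b = \<phi> e"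
      using eq abce inG by (simp_all add: Q.m_ac)
    then have "\<phi> a = \<phi> e" "\<phi> b = \<phi> e" "\<phi> c = \<phi> e"
      using same[OF abce eq] same abce by blast+
    with eq have eee: "\<phi> e \<otimes>\<^bsub>Q\<^esub> \<phi> e \<otimes>\<^bsub>Q\<^esub> \<phi> e = \<phi> e" by simp
    have eQ: "\<phi> e \<in> carrier Q" using abce inG by auto
    have ee: "\<phi> e \<otimes>\<^bsub>Q\<^esub> \<phi> e = \<one>\<^bsub>Q\<^esub>" using eee eQ by (metis Q.m_closed Q.r_cancel_one)
    have "\<phi> t = \<phi> e" if t: "t \<in> A" for t
    proof (rule same[symmetric])
      show "\<phi> e \<otimes>\<^bsub>Q\<^esub> \<phi> e \<otimes>\<^bsub>Q\<^esub> \<phi> t = \<phi> t" using ee inG[OF t] by simp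
    qed (use abce t in auto)
    then have "A \<inter> fib e = A" using inG by (auto simp: fib_def)
    then show "2 * card A \<le> card (kernel G Q \<phi>)"
      using bound[OF abce(4) abce(4) abce(4) abce(4) eee] by (simp add: H_def)
  qed
  then show ?thesis by blast
qed

end

section \<open>Sum-free sets with large sumsets\<close>

context finite_comm_group
begin

lemma inverse_set_mult_disjoint:
  assumes sf: "sum_free_3_1 G A"
  shows "(m_inv G ` A <#> A) \<inter> (A <#> A) = {}"
proof -
  have A: "\<And>x. x \<in> A \<Longrightarrow> x \<in> carrier G"
    and rel: "\<And>a b c. a \<in> A \<Longrightarrow> b \<in> A \<Longrightarrow> c \<in> A \<Longrightarrow> a \<otimes> b \<otimes> c \<notin> A"
    using sf by (auto simp: sum_free_3_1_iff)
  have False if "inv a \<otimes> b = c \<otimes> d" "a \<in> A" "b \<in> A" "c \<in> A" "d \<in> A" for a b c d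
  proof -
    have G: "a \<in> carrier G" "b \<in> carrier G" "c \<in> carrier G" "d \<in> carrier G" using that A by auto
    then have "a \<otimes> c \<otimes> d = a \<otimes> (inv a \<otimes> b)" unfolding that(1) by (simp add: m_assoc)
    also have "\<dots> = b" using G by (simp add: m_assoc[symmetric])
    finally show False using rel that by metis
  qed
  then show ?thesis by (auto simp: in_set_mult_iff)
qed

text \<open>
  \<open>A <#> A\<close> and the set of quotients of \<open>A\<close> are disjoint, and by the expansion hypothesis each of them
  has at least \<open>2 * card A - 1\<close> elements.
\<close>

lemma sum_free_expanding_card_le:
  assumes sf: "sum_free_3_1 G A" and ne: "A \<noteq> {}"
    and expand: "\<And>X. X \<subseteq> carrier G \<Longrightarrow> X \<noteq> {} \<Longrightarrow> X <#> A \<noteq> carrier G \<Longrightarrow>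
      card X + card A \<le> card (X <#> A) + 1"
  shows "2 * card A \<le> card (A <#> A) + 1" "2 * card A \<le> card (m_inv G ` A <#> A) + 1"
    "card (m_inv G ` A <#> A) + card (A <#> A) \<le> card (carrier G)"
    "4 * card A \<le> card (carrier G) + 2"
proof -
  let ?B = "m_inv G ` A"
  have A: "A \<subseteq> carrier G" using sf by (simp add: sum_free_3_1_def)
  then have B: "?B \<subseteq> carrier G" by auto
  have sub: "A <#> A \<subseteq> carrier G" "?B <#> A \<subseteq> carrier G"
    using A B by (intro set_mult_closed; simp)+
  have disj: "(?B <#> A) \<inter> (A <#> A) = {}" by (rule inverse_set_mult_disjoint[OF sf])
  from ne obtain a where "a \<in> A" by blast
  then have nes: "A <#> A \<noteq> {}" "?B <#> A \<noteq> {}" by (auto simp: set_mult_def)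
  show 1: "2 * card A \<le> card (A <#> A) + 1" using expand[OF A ne] nes disj sub by fastforce
  have "?B <#> A \<noteq> carrier G" using nes disj sub by blast
  with expand[OF B] ne show 2: "2 * card A \<le> card (?B <#> A) + 1"
    by (simp add: card_inverses[OF A])
  show 3: "card (?B <#> A) + card (A <#> A) \<le> card (carrier G)"
    by (rule disjoint_card_le[OF finite_carrier sub(2) sub(1) disj])
  show "4 * card A \<le> card (carrier G) + 2" using 1 2 3 by linarith
qed

text \<open>
  Suppose that equality holds, and let \<open>k = card A\<close>, \<open>D\<close> the set of quotients of \<open>A\<close>, \<open>S = A <#> A\<close> and
  \<open>T = A <#> A <#> A\<close>. Equality in the previous bounds makes \<open>S\<close> the complement of \<open>D\<close>, both of size
  \<open>2 * k - 1\<close>, and \<open>T\<close> the complement of \<open>A\<close>. The set \<open>D\<close> contains \<open>\<one>\<close>, is closed under inverses and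
  has odd size, so it cannot contain the unique involution \<open>t\<close>. Hence \<open>A\<close> and its translate by
  \<open>t\<close> are disjoint; their union has more than half of the elements of \<open>G\<close>, so its quotients cover \<open>G\<close>,
  that is, \<open>D\<close> and its translate by \<open>t\<close> cover \<open>G\<close>. It follows that \<open>S\<close> is the translate of \<open>D\<close> by \<open>t\<close>.
  Substituting this for \<open>S\<close> shows that \<open>T\<close>, and with it its complement \<open>A\<close>, is invariant under the
  reflection \<open>x \<mapsto> t \<otimes> inv x\<close>. A fixed point of the reflection would be a square root of \<open>t\<close>, so
  \<open>card A\<close> is even, a contradiction.
\<close>

lemma sum_free_expanding_not_extremal:
  assumes sf: "sum_free_3_1 G A" and ne: "A \<noteq> {}"
    and expand: "\<And>X. X \<subseteq> carrier G \<Longrightarrow> X \<noteq> {} \<Longrightarrow> X <#> A \<noteq> carrier G \<Longrightarrow>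
      card X + card A \<le> card (X <#> A) + 1"
    and t: "t \<in> carrier G" "t \<noteq> \<one>" "t \<otimes> t = \<one>"
    and t_unique: "\<And>x. x \<in> carrier G \<Longrightarrow> x \<otimes> x = \<one> \<Longrightarrow> x = \<one> \<or> x = t"
    and t_nonsquare: "\<And>x. x \<in> carrier G \<Longrightarrow> x \<otimes> x \<noteq> t"
    and odd: "odd (card A)"
  shows "4 * card A \<noteq> card (carrier G) + 2"
proof
  assume n: "4 * card A = card (carrier G) + 2"
  define k where "k = card A"
  define B where "B = m_inv G ` A"
  define D where "D = B <#> A"
  define S where "S = A <#> A"
  define T where "T = S <#> A"
  have inG: "x \<in> carrier G" if "x \<in> A" for x using that sf by (auto simp: sum_free_3_1_iff)
  have A: "A \<subseteq> carrier G" using inG by blast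
  have rel: "\<And>a b c. a \<in> A \<Longrightarrow> b \<in> A \<Longrightarrow> c \<in> A \<Longrightarrow> a \<otimes> b \<otimes> c \<notin> A"
    using sf by (auto simp: sum_free_3_1_iff)
  have B: "B \<subseteq> carrier G" using A by (auto simp: B_def)
  have D: "D \<subseteq> carrier G" and S: "S \<subseteq> carrier G"
    unfolding D_def S_def using A B by (intro set_mult_closed; simp)+
  then have T: "T \<subseteq> carrier G" unfolding T_def using A by (intro set_mult_closed; simp)
  have D_iff: "x \<in> D \<longleftrightarrow> (\<exists>a\<in>A. \<exists>b\<in>A. x = inv a \<otimes> b)" for x
    by (auto simp: D_def B_def in_set_mult_iff)
  have tt: "t \<otimes> (t \<otimes> x) = x" if "x \<in> carrier G" for x
    using t that by (simp add: m_assoc[symmetric])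
  have inv_t: "inv t = t" using t by (simp add: inv_equality)
  have cards: "card D = 2 * k - 1" "card S = 2 * k - 1" and k: "k \<ge> 1"
    using sum_free_expanding_card_le[OF sf ne expand] n odd
    unfolding D_def B_def S_def k_def by (auto elim: oddE)
  have SD: "S = carrier G - D"
  proof (rule card_subset_eq)
    show "S \<subseteq> carrier G - D"
      using S inverse_set_mult_disjoint[OF sf] by (auto simp: D_def B_def S_def)
    show "card S = card (carrier G - D)"
      using cards n D by (simp add: card_Diff_subset finite_sub k_def)
  qed simp
  have TA: "T = carrier G - A"
  proof -
    have sub: "T \<subseteq> carrier G - A" using T rel by (auto simp: T_def S_def in_set_mult_iff)
    have "S \<noteq> {}" using cards k by auto
    moreover have "T \<noteq> carrier G" using sub ne A by blast
    ultimately have "card S + k \<le> card T + 1" using expand[of S] S by (simp add: T_def k_def)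
    then have "card (carrier G - A) \<le> card T"
      using cards n A by (simp add: card_Diff_subset finite_sub k_def)
    then show ?thesis using sub by (intro card_seteq) auto
  qed
  have inv_D: "inv x \<in> D" if "x \<in> D" for x
  proof -
    from that obtain a b where ab: "a \<in> A" "b \<in> A" "x = inv a \<otimes> b" by (auto simp: D_iff)
    then have "inv x = inv b \<otimes> a" using inG by (simp add: inv_mult m_comm)
    then show ?thesis using ab D_iff by blast
  qed
  have inv_S: "inv x \<in> S" if "x \<in> S" for x
    using that inv_D[of "inv x"] by (auto simp: SD)
  have one_D: "\<one> \<in> D" using ne inG by (auto simp: D_iff) (metis l_inv)
  have t_notin_D: "t \<notin> D"
  proof
    assume tD: "t \<in> D"
    have "even (card (D - {\<one>, t}))"
    proof (rule even_card_fixpoint_free_involution[where f = "m_inv G"])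
      show "finite (D - {\<one>, t})" using D by auto
      fix x assume x: "x \<in> D - {\<one>, t}"
      then have xG: "x \<in> carrier G" using D by auto
      then show "inv (inv x) = x" by simp
      have "inv x \<noteq> \<one>" "inv x \<noteq> t" using x xG inv_t by (metis DiffE inv_inv inv_one insertCI)+
      then show "inv x \<in> D - {\<one>, t}" using inv_D x by auto
      show "inv x \<noteq> x" using x t_unique[OF xG] xG by (metis DiffE insertCI l_inv)
    qed
    moreover have "card (D - {\<one>, t}) = card D - 2"
      using tD one_D t by (subst card_Diff_subset) auto
    moreover have "card {\<one>, t} \<le> card D"
      using D tD one_D by (intro card_mono) auto
    ultimately show False using cards k t by simp
  qed
  have cover: "c \<in> D \<or> t \<otimes> c \<in> D" if c: "c \<in> carrier G" for c
  proof -
    define P where "P = A \<union> (\<otimes>) t ` A"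
    have PG: "P \<subseteq> carrier G" using A t by (auto simp: P_def)
    have "A \<inter> (\<otimes>) t ` A = {}"
    proof -
      have False if "a \<in> A" "b \<in> A" "a = t \<otimes> b" for a b
      proof -
        have "inv b \<otimes> a = t" using that inG t by (simp add: m_lcomm)
        then show False using that t_notin_D D_iff by blast
      qed
      then show ?thesis by blast
    qed
    then have "card P = 2 * k"
      unfolding P_def k_def using A card_translate[OF t(1) A]
      by (subst card_Un_disjoint) auto
    then have "\<not> card P + card ((\<otimes>) c ` P) \<le> card (carrier G)"
      using card_translate[OF c PG] n unfolding k_def by linarith
    then have "P \<inter> (\<otimes>) c ` P \<noteq> {}"
      using disjoint_card_le[OF finite_carrier PG, of "(\<otimes>) c ` P"] PG c by blast
    then obtain p q where pq: "p \<in> P" "q \<in> P" "p = c \<otimes> q" by blast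
    \<comment> \<open>\<open>s u\<close> ranges over the subgroup \<open>{\<one>, t}\<close>, so that \<open>P\<close> consists of the \<open>s u \<otimes> a\<close> with \<open>a \<in> A\<close>.\<close>
    define s where "s u = (if u then t else \<one>)" for u
    have Ps: "\<exists>u. \<exists>a\<in>A. x = s u \<otimes> a" if "x \<in> P" for x
    proof -
      have "x \<in> A \<Longrightarrow> x = s False \<otimes> x" using inG by (simp add: s_def)
      moreover have "x \<in> (\<otimes>) t ` A \<Longrightarrow> \<exists>a\<in>A. x = s True \<otimes> a" by (auto simp: s_def)
      ultimately show ?thesis using that unfolding P_def by blast
    qed
    have s: "s u \<in> carrier G" "s u \<otimes> s u = \<one>" for u using t by (auto simp: s_def)
    from pq Ps obtain u v a b where ab: "a \<in> A" "b \<in> A" "s u \<otimes> a = c \<otimes> (s v \<otimes> b)" by metis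
    note G = inG[OF ab(1)] inG[OF ab(2)]
    have "inv b \<otimes> a = inv b \<otimes> (s u \<otimes> s u \<otimes> a)" using s G by simp
    also have "\<dots> = inv b \<otimes> (s u \<otimes> (s u \<otimes> a))" by (simp only: m_assoc[OF s(1) s(1) G(1)])
    also have "\<dots> = s u \<otimes> s v \<otimes> c \<otimes> (inv b \<otimes> b)" unfolding ab(3) using s(1) G c
      by (simp only: m_ac m_closed inv_closed)
    also have "\<dots> = s u \<otimes> s v \<otimes> c" using s G c by simp
    finally have "s u \<otimes> s v \<otimes> c \<in> D" using ab D_iff by metis
    then show ?thesis using t c by (cases u; cases v) (simp_all add: s_def)
  qed
  have S_tD: "t \<otimes> x \<in> D" if "x \<in> S" for x using that cover by (auto simp: SD)
  have T_refl: "t \<otimes> inv x \<in> T" if x: "x \<in> T" for x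
  proof -
    from x obtain s a where sa: "s \<in> S" "a \<in> A" "x = s \<otimes> a" by (auto simp: T_def in_set_mult_iff)
    from S_tD[OF sa(1)] obtain b c where bc: "b \<in> A" "c \<in> A" "t \<otimes> s = inv b \<otimes> c"
      by (auto simp: D_iff)
    have G: "s \<in> carrier G" "a \<in> carrier G" "b \<in> carrier G" "c \<in> carrier G"
      using sa bc S inG by auto
    have "t \<otimes> x = inv b \<otimes> (c \<otimes> a)"
      using sa bc G t by (metis m_assoc inv_closed)
    then have "inv (t \<otimes> x) = inv (inv b \<otimes> (c \<otimes> a))" by simp
    then have "t \<otimes> inv x = inv (c \<otimes> a) \<otimes> b"
      using sa G t by (simp add: inv_mult inv_t m_ac)
    moreover have "inv (c \<otimes> a) \<in> S"
      using inv_S[of "c \<otimes> a"] sa bc by (auto simp: S_def in_set_mult_iff)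
    ultimately show ?thesis using bc by (auto simp: T_def in_set_mult_iff)
  qed
  have "even (card A)"
  proof (rule even_card_fixpoint_free_involution[where f = "\<lambda>x. t \<otimes> inv x"])
    show "finite A" using A by auto
    fix x assume x: "x \<in> A"
    note xG = inG[OF x]
    show invol: "t \<otimes> inv (t \<otimes> inv x) = x" using xG t by (simp add: inv_mult inv_t tt)
    show "t \<otimes> inv x \<in> A"
    proof (rule ccontr)
      assume "t \<otimes> inv x \<notin> A"
      then have "t \<otimes> inv x \<in> T" using xG t by (simp add: TA)
      from T_refl[OF this] show False using x unfolding invol TA by simp
    qed
    show "t \<otimes> inv x \<noteq> x"
    proof
      assume "t \<otimes> inv x = x"
      then have "x \<otimes> x = t \<otimes> inv x \<otimes> x" by simp
      also have "\<dots> = t" using xG t by (simp add: m_assoc)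
      finally show False using t_nonsquare xG by blast
    qed
  qed
  with odd show False by simp
qed

end

section \<open>The maximum over divisors\<close>

text \<open>
  \<open>(d + 2) div 4\<close> is the length of the longest \<open>(3, 1)\<close>-sum-free interval modulo \<open>d\<close> when
  \<open>d mod 4 \<noteq> 2\<close>, and \<open>n div d\<close> is the size of a residue class modulo \<open>d\<close> in \<open>{0..<n}\<close>.
\<close>

definition interval_value :: "nat \<Rightarrow> nat" where
  "interval_value n = Max {((d + 2) div 4) * (n div d) | d :: nat. d > 0 \<and> d dvd n \<and> [d \<noteq> 2] (mod 4)}"

lemma finite_interval_values:
  fixes n :: nat
  assumes "n > 0"
  shows "finite {((d + 2) div 4) * (n div d) | d :: nat. d > 0 \<and> d dvd n \<and> [d \<noteq> 2] (mod 4)}"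
proof -
  have "finite ((\<lambda>d. ((d + 2) div 4) * (n div d)) ` {d. d dvd n})" using assms by simp
  then show ?thesis by (rule finite_subset[rotated]) auto
qed

lemma interval_value_ge:
  assumes "n > 0" "d dvd n" "d mod 4 \<noteq> 2"
  shows "((d + 2) div 4) * (n div d) \<le> interval_value n"
  unfolding interval_value_def
  by (rule Max_ge[OF finite_interval_values]) (use assms in \<open>auto simp: cong_def dvd_pos_nat\<close>)

lemma interval_value_attained:
  assumes "n > 0"
  obtains d where "d > 0" "d dvd n" "d mod 4 \<noteq> 2" "interval_value n = ((d + 2) div 4) * (n div d)"
proof -
  have "interval_value n \<in> {((d + 2) div 4) * (n div d) | d :: nat. d > 0 \<and> d dvd n \<and> [d \<noteq> 2] (mod 4)}"
    unfolding interval_value_def using finite_interval_values[OF assms]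
    by (rule Max_in) (auto simp: cong_def intro!: exI[of _ 1])
  then show thesis using that by (auto simp: cong_def)
qed

lemma interval_value_dvd:
  assumes "n > 0" "d dvd n"
  shows "interval_value d * (n div d) \<le> interval_value n"
proof -
  have d: "d > 0" using assms by (auto intro: dvd_pos_nat)
  obtain e where e: "e > 0" "e dvd d" "e mod 4 \<noteq> 2" "interval_value d = ((e + 2) div 4) * (d div e)"
    using interval_value_attained[OF d] by blast
  have "(d div e) * (n div d) = n div e"
    using e(1,2) assms(2) d by (auto elim!: dvdE)
  then have "interval_value d * (n div d) = ((e + 2) div 4) * (n div e)"
    using e(4) by (simp add: mult.assoc)
  also have "\<dots> \<le> interval_value n"
    using e assms by (intro interval_value_ge) auto
  finally show ?thesis .
qed

text \<open>
  For odd \<open>m\<close> the divisor \<open>2 * m\<close> does not take part in the maximum, and \<open>m\<close> replaces it. The term of \<open>m\<close>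
  is \<open>(2 * m + 2) div 4\<close> if \<open>m mod 4 = 3\<close>, and one less if \<open>m mod 4 = 1\<close>.
\<close>

lemma interval_value_even_ge:
  assumes "m > 0"
  shows "m mod 4 = 3 \<Longrightarrow> (2 * m + 2) div 4 \<le> interval_value (2 * m)"
    and "m mod 4 = 1 \<Longrightarrow> (2 * m) div 4 \<le> interval_value (2 * m)"
proof -
  have v: "((m + 2) div 4) * 2 \<le> interval_value (2 * m)" if "m mod 4 \<noteq> 2"
    using interval_value_ge[of "2 * m" m] assms that by simp
  show "(2 * m + 2) div 4 \<le> interval_value (2 * m)" if m3: "m mod 4 = 3"
  proof -
    obtain q where "m = 4 * q + 3" using m3 by (metis mult_div_mod_eq)
    then have "(2 * m + 2) div 4 = (m + 2) div 4 * 2" by simp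
    then show ?thesis using v m3 by simp
  qed
  show "(2 * m) div 4 \<le> interval_value (2 * m)" if m1: "m mod 4 = 1"
  proof -
    obtain q where "m = 4 * q + 1" using m1 by (metis mult_div_mod_eq)
    then have "(2 * m) div 4 = (m + 2) div 4 * 2" by simp
    then show ?thesis using v m1 by simp
  qed
qed

lemma interval_value_ge_quarter:
  assumes "n > 0"
  shows "n div 4 \<le> interval_value n"
proof (cases "n mod 4 = 2")
  case True
  define m where "m = n div 2"
  have n: "n = 2 * m" "m > 0" "m mod 4 = 1 \<or> m mod 4 = 3" using True assms unfolding m_def by presburger+
  show ?thesis using interval_value_even_ge[OF n(2)] n(3) unfolding n(1)
    by (metis div_le_mono le_add1 order_trans)
next
  case False
  then have "(n + 2) div 4 \<le> interval_value n" using interval_value_ge[of n n] assms by simp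
  moreover have "n div 4 \<le> (n + 2) div 4" by (simp add: div_le_mono)
  ultimately show ?thesis by simp
qed

section \<open>Cyclic groups and reduction modulo a divisor\<close>

lemma card_residue_class:
  assumes "n > 0" "d dvd n" "r \<in> {0..<int d}"
  shows "card {x \<in> {0..<int n}. x mod int d = r} = n div d"
proof -
  from assms(2) obtain h where n: "n = d * h" by blast
  have d: "d > 0" using assms n by (cases d) auto
  have "{x \<in> {0..<int n}. x mod int d = r} = (\<lambda>i. r + int d * i) ` {0..<int h}"
  proof (intro equalityI subsetI)
    fix x assume x: "x \<in> {x \<in> {0..<int n}. x mod int d = r}"
    have "x = r + int d * (x div int d)" using x by auto
    moreover have "x div int d < int h"
    proof (rule mult_left_less_imp_less)
      have "int d * (x div int d) \<le> x" using mult_div_mod_eq[of "int d" x] d by (smt (verit) pos_mod_sign of_nat_0_less_iff)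
      then show "int d * (x div int d) < int d * int h" using x unfolding n by simp
    qed simp
    then have "x div int d \<in> {0..<int h}" using x d by (simp add: pos_imp_zdiv_nonneg_iff)
    ultimately show "x \<in> (\<lambda>i. r + int d * i) ` {0..<int h}" by (rule image_eqI)
  next
    fix x assume "x \<in> (\<lambda>i. r + int d * i) ` {0..<int h}"
    then obtain i where i: "0 \<le> i" "i \<le> int h - 1" and x: "x = r + int d * i" by auto
    have "int d * i \<le> int d * (int h - 1)" using i by (intro mult_left_mono) auto
    moreover have "int d * i \<ge> 0" using i by simp
    ultimately show "x \<in> {x \<in> {0..<int n}. x mod int d = r}"
      using assms(3) unfolding x n by (auto simp: algebra_simps)
  qed
  moreover have "inj_on (\<lambda>i. r + int d * i) {0..<int h}" using d by (auto simp: inj_on_def)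
  ultimately show ?thesis using d by (simp add: card_image n)
qed

lemma card_residue_preimage:
  assumes "n > 0" "d dvd n" "R \<subseteq> {0..<int d}"
  shows "card {x \<in> {0..<int n}. x mod int d \<in> R} = card R * (n div d)"
proof -
  have "{x \<in> {0..<int n}. x mod int d \<in> R} = (\<Union>r\<in>R. {x \<in> {0..<int n}. x mod int d = r})" by auto
  also have "card \<dots> = (\<Sum>r\<in>R. card {x \<in> {0..<int n}. x mod int d = r})"
  proof (rule card_UN_disjoint)
    show "finite R" using finite_subset[OF assms(3)] by simp
    show "\<forall>r\<in>R. finite {x \<in> {0..<int n}. x mod int d = r}"
    proof
      show "finite {x \<in> {0..<int n}. x mod int d = r}" for r
        by (rule finite_subset[of _ "{0..<int n}"]) auto
    qed
  qed auto
  also have "\<dots> = card R * (n div d)"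
    using card_residue_class[OF assms(1,2)] assms(3) by (simp add: subset_iff)
  finally show ?thesis .
qed

lemma finite_comm_group_integer_mod_group:
  assumes "n > 0"
  shows "finite_comm_group (integer_mod_group n)"
proof -
  interpret comm_group "integer_mod_group n" by (rule abelian_integer_mod_group)
  show ?thesis by unfold_locales (use assms in \<open>simp add: carrier_integer_mod_group\<close>)
qed

lemma reduction_hom:
  assumes "n > 0" "d dvd n"
  shows "(\<lambda>x. x mod int d) \<in> hom (integer_mod_group n) (integer_mod_group d)"
    and "kernel (integer_mod_group n) (integer_mod_group d) (\<lambda>x. x mod int d) =
      {x \<in> {0..<int n}. x mod int d = 0}"
proof -
  have d: "d > 0" using assms by (auto intro: dvd_pos_nat)
  have "int d dvd int n" using assms by simp
  then show "(\<lambda>x. x mod int d) \<in> hom (integer_mod_group n) (integer_mod_group d)"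
    using d by (intro homI) (auto simp: carrier_integer_mod_group mod_mod_cancel mod_add_eq)
qed (use assms in \<open>auto simp: kernel_def carrier_integer_mod_group\<close>)

lemma sum_free_reduction_preimage:
  assumes "n > 0" "d dvd n" and sf: "sum_free_3_1 (integer_mod_group d) R"
  shows "sum_free_3_1 (integer_mod_group n) {x \<in> {0..<int n}. x mod int d \<in> R}"
proof -
  interpret N: comm_group "integer_mod_group n" by (rule abelian_integer_mod_group)
  interpret D: comm_group "integer_mod_group d" by (rule abelian_integer_mod_group)
  have "int d dvd int n" using assms by simp
  then have "((x + y) mod int n + z) mod int n mod int d
      = ((x mod int d + y mod int d) mod int d + z mod int d) mod int d" for x y z
    by (simp add: mod_mod_cancel mod_simps)
  then show ?thesis using assms(1) sf
    unfolding N.sum_free_3_1_iff D.sum_free_3_1_iff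
    by (simp add: carrier_integer_mod_group subset_iff)
qed

text \<open>
  For an interval that starts at \<open>a\<close> and has length \<open>k\<close>, the threefold sums form an interval that starts
  at \<open>3 * a\<close> and has length \<open>3 * k - 2\<close>. It fits into the gap from \<open>a + k\<close> to \<open>a + d - 1\<close>
  when \<open>k \<le> 2 * a \<le> d - 3 * k + 2\<close>. As \<open>4 * k - 1 \<le> d\<close> for \<open>k > 0\<close>, this range for \<open>2 * a\<close> contains \<open>k\<close> and
  \<open>k + 1\<close>, one of which is even.
\<close>

lemma sum_free_interval:
  assumes d: "d > 0" "d mod 4 \<noteq> 2"
  defines "k \<equiv> int ((d + 2) div 4)"
  defines "a \<equiv> (k + 1) div 2"
  shows "{a..<a + k} \<subseteq> {0..<int d}" "sum_free_3_1 (integer_mod_group d) {a..<a + k}"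
proof -
  interpret D: comm_group "integer_mod_group d" by (rule abelian_integer_mod_group)
  have k: "k \<ge> 0" by (simp add: k_def)
  have kd: "k > 0 \<Longrightarrow> 4 * k - 1 \<le> int d" using d unfolding k_def by presburger
  have a: "k \<le> 2 * a" "2 * a \<le> k + 1" unfolding a_def by linarith+
  show sub: "{a..<a + k} \<subseteq> {0..<int d}" using k kd a by auto
  have "(((x + y) mod int d + z) mod int d) \<notin> {a..<a + k}"
    if "x \<in> {a..<a + k}" "y \<in> {a..<a + k}" "z \<in> {a..<a + k}" for x y z
  proof -
    let ?u = "x + y + z"
    have kpos: "k > 0" using that by auto
    have u: "3 * a \<le> ?u" "?u \<le> 3 * a + 3 * k - 3" using that by auto
    have "?u mod int d \<notin> {a..<a + k}"
    proof (cases "?u < int d")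
      case True
      then have "?u mod int d = ?u" using u a k by (intro mod_pos_pos_trivial) auto
      then show ?thesis using u a by auto
    next
      case False
      have "?u - int d < a" using u a kd[OF kpos] by linarith
      moreover have "a < int d" using a kd[OF kpos] kpos by linarith
      ultimately have "?u mod int d = ?u - int d"
        using False by (metis linorder_not_le mod_pos_pos_trivial diff_ge_0_iff_ge minus_mod_self2 order.strict_trans)
      then show ?thesis using \<open>?u - int d < a\<close> by auto
    qed
    then show ?thesis by (simp add: mod_simps)
  qed
  then show "sum_free_3_1 (integer_mod_group d) {a..<a + k}"
    using sub d unfolding D.sum_free_3_1_iff by (auto simp: carrier_integer_mod_group)
qed

text \<open>
  Multiplication by \<open>card H\<close> annihilates \<open>H\<close>, so all elements of \<open>H\<close> are multiples of \<open>n div card H\<close>, and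
  there are only \<open>card H\<close> such multiples.
\<close>

lemma subgroup_eq_reduction_kernel:
  assumes n: "n > 0" and H: "subgroup H (integer_mod_group n)"
  shows "card H dvd n" "H = {x \<in> {0..<int n}. x mod int (n div card H) = 0}"
proof -
  interpret finite_comm_group "integer_mod_group n" by (rule finite_comm_group_integer_mod_group[OF n])
  interpret H: subgroup H "integer_mod_group n" by (rule H)
  let ?h = "card H" and ?G = "integer_mod_group n"
  have HG: "H \<subseteq> {0..<int n}" using H.subset n by (simp add: carrier_integer_mod_group)
  have fin: "finite H" using HG by (rule finite_subset) simp
  have "H \<noteq> {}" using H.one_closed by blast
  then have hpos: "?h > 0" using fin by (simp add: card_gt_0_iff)
  have "order ?G = n" using n by (simp add: order_def carrier_integer_mod_group)
  then have "card (rcosets\<^bsub>?G\<^esub> H) * ?h = n" using lagrange[OF H] by simp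
  then show hn: "?h dvd n" by (metis dvd_triv_right)
  define d where "d = n div ?h"
  have nd: "n = ?h * d" using hn by (simp add: d_def)
  have "H \<subseteq> {x \<in> {0..<int n}. x mod int d = 0}"
  proof
    fix x assume x: "x \<in> H"
    interpret HG: group "?G\<lparr>carrier := H\<rparr>" by (rule subgroup_imp_group[OF H])
    have "x [^]\<^bsub>?G\<^esub> ?h = \<one>\<^bsub>?G\<^esub>"
      using HG.pow_order_eq_1[of x] x by (simp add: order_def flip: nat_pow_consistent)
    then have "(int ?h * x) mod int n = 0" by simp
    then have "int ?h * int d dvd int ?h * x" unfolding nd by (simp add: dvd_eq_mod_eq_0)
    then have "int d dvd x" using hpos by simp
    then show "x \<in> {x \<in> {0..<int n}. x mod int d = 0}" using x HG by auto
  qed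
  moreover have "d > 0" using n nd by (cases d) auto
  then have "card {x \<in> {0..<int n}. x mod int d = 0} = ?h"
    using card_residue_class[OF n, of d 0] nd by simp
  ultimately show "H = {x \<in> {0..<int n}. x mod int (n div card H) = 0}"
    unfolding d_def[symmetric]
    by (intro card_subset_eq finite_subset[of "{x \<in> {0..<int n}. _ x}" "{0..<int n}"]) auto
qed

section \<open>The maximum size of a sum-free set in a cyclic group\<close>

text \<open>
  If \<open>A\<close> expands, then \<open>card A \<le> (n + 2) div 4\<close>, which is the term of the divisor \<open>n\<close> unless
  \<open>n mod 4 = 2\<close>; in that case \<open>n div 2\<close> yields the same term, or the extremal size is odd and is ruled out
  by the involution \<open>n div 2\<close> of the group. Otherwise there is a subgroup \<open>H\<close> such that \<open>A\<close> nearly fills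
  the cosets of \<open>H\<close> that it meets. Then either the reduction of \<open>A\<close> modulo the index of \<open>H\<close> is
  sum-free, and induction applies, or \<open>A\<close> has at most half the size of a proper subgroup, hence at most
  \<open>n div 4\<close> elements.
\<close>

lemma sum_free_card_le:
  assumes "n > 0" "sum_free_3_1 (integer_mod_group n) A"
  shows "card A \<le> interval_value n"
  using assms
proof (induction n arbitrary: A rule: less_induct)
  case (less n)
  let ?G = "integer_mod_group n"
  interpret finite_comm_group ?G by (rule finite_comm_group_integer_mod_group[OF less.prems(1)])
  have cG: "carrier ?G = {0..<int n}" using less.prems(1) by (simp add: carrier_integer_mod_group)
  then have card_G: "card (carrier ?G) = n" by simp
  have A: "A \<subseteq> carrier ?G" using less.prems(2) by (simp add: sum_free_3_1_def)
  show ?case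
  proof (cases "A = {}")
    case False
    from isoperimetric_alternative[OF A] show ?thesis
    proof (elim disjE exE conjE)
      assume "\<forall>X. X \<subseteq> carrier ?G \<and> X \<noteq> {} \<and> X <#>\<^bsub>?G\<^esub> A \<noteq> carrier ?G \<longrightarrow>
        card X + card A \<le> card (X <#>\<^bsub>?G\<^esub> A) + 1"
      then have expand: "\<And>X. X \<subseteq> carrier ?G \<Longrightarrow> X \<noteq> {} \<Longrightarrow> X <#>\<^bsub>?G\<^esub> A \<noteq> carrier ?G \<Longrightarrow>
        card X + card A \<le> card (X <#>\<^bsub>?G\<^esub> A) + 1" by blast
      have le: "4 * card A \<le> n + 2"
        using sum_free_expanding_card_le(4)[OF less.prems(2) False expand] card_G by simp
      show ?thesis
      proof (cases "n mod 4 = 2")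
        case False
        have "card A \<le> (n + 2) div 4" using le by simp
        also have "\<dots> \<le> interval_value n"
          using interval_value_ge[of n n] less.prems(1) False by simp
        finally show ?thesis .
      next
        case n2: True
        define m where "m = n div 2"
        have n: "n = 2 * m" using n2 unfolding m_def by presburger
        have m_odd: "odd m" and m: "m > 0" "m mod 4 = 1 \<or> m mod 4 = 3"
          using n2 n by presburger+
        show ?thesis
        proof (cases "m mod 4 = 3")
          case True
          have "card A \<le> (n + 2) div 4" using le by simp
          then show ?thesis using interval_value_even_ge(1)[OF m(1) True] unfolding n by linarith
        next
          case False
          then have m1: "m mod 4 = 1" using m by simp
          have "4 * card A \<noteq> n + 2"
          proof
            assume eq: "4 * card A = n + 2"
            then have odd: "odd (card A)" using m1 unfolding n by presburger
            have "4 * card A \<noteq> card (carrier ?G) + 2"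
            proof (rule sum_free_expanding_not_extremal
                [OF less.prems(2) \<open>A \<noteq> {}\<close> expand _ _ _ _ _ odd, where t = "int m"])
              show "int m \<in> carrier ?G" "int m \<noteq> \<one>\<^bsub>?G\<^esub>" "int m \<otimes>\<^bsub>?G\<^esub> int m = \<one>\<^bsub>?G\<^esub>"
                using m(1) by (simp_all add: carrier_integer_mod_group n)
              show "x = \<one>\<^bsub>?G\<^esub> \<or> x = int m" if "x \<in> carrier ?G" "x \<otimes>\<^bsub>?G\<^esub> x = \<one>\<^bsub>?G\<^esub>" for x
              proof -
                have "x \<in> {0..<int n}" using that(1) unfolding cG .
                then have x: "0 \<le> x" "x < 2 * int m" by (simp_all add: n)
                have "(2 * x) mod (2 * int m) = 0" using that(2) by (simp add: n)
                then have "x mod int m = 0" by (simp add: mult_mod_right[symmetric])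
                then have "x = 0 \<or> x = int m"
                  using x m(1) by (smt (verit) minus_mod_self2 mod_pos_pos_trivial)
                then show ?thesis by simp
              qed
              show "x \<otimes>\<^bsub>?G\<^esub> x \<noteq> int m" if "x \<in> carrier ?G" for x
              proof
                assume "x \<otimes>\<^bsub>?G\<^esub> x = int m"
                then have "2 * x mod (2 * int m) = int m" by (simp add: n)
                then have "2 * (x mod int m) = int m" by (simp flip: mult_mod_right)
                then have "even (int m)" by (metis dvd_triv_left)
                then show False using m_odd by simp
              qed
            qed
            then show False using eq card_G by simp
          qed
          then have "card A \<le> (2 * m) div 4" using le m1 unfolding n by presburger
          then show ?thesis using interval_value_even_ge(2)[OF m(1) m1] unfolding n by linarith
        qed
      qed
    next
      fix H assume H: "subgroup H ?G" and proper: "H <#>\<^bsub>?G\<^esub> A \<noteq> carrier ?G"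
        and small: "card (H <#>\<^bsub>?G\<^esub> A) + 1 < card H + card A"
      define h where "h = card H"
      define d where "d = n div h"
      have hn: "h dvd n" unfolding h_def by (rule subgroup_eq_reduction_kernel(1)[OF less.prems(1) H])
      have nd: "n = h * d" using hn by (simp add: d_def)
      then have dn: "d dvd n" and d: "d > 0" using less.prems(1) by auto
      have HG: "H \<subseteq> carrier ?G" and oneH: "\<one>\<^bsub>?G\<^esub> \<in> H"
        by (rule subgroup.subset[OF H], rule subgroup.one_closed[OF H])
      have "A \<subseteq> H <#>\<^bsub>?G\<^esub> A"
      proof
        fix a assume a: "a \<in> A"
        then have "a = \<one>\<^bsub>?G\<^esub> \<otimes>\<^bsub>?G\<^esub> a" using A by (intro l_one[symmetric]) blast
        with a oneH show "a \<in> H <#>\<^bsub>?G\<^esub> A" unfolding in_set_mult_iff by blast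
      qed
      then have "card A \<le> card (H <#>\<^bsub>?G\<^esub> A)"
        using HG A by (intro card_mono finite_sub set_mult_closed)
      then have "h > 1" using small unfolding h_def by linarith
      then have "d < n" using nd d by simp
      have "H \<noteq> carrier ?G"
      proof
        assume HG': "H = carrier ?G"
        from \<open>A \<noteq> {}\<close> obtain a where a: "a \<in> A" "a \<in> carrier ?G" using A by blast
        have "carrier ?G \<subseteq> H <#>\<^bsub>?G\<^esub> A"
        proof
          fix x assume x: "x \<in> carrier ?G"
          have "x = x \<otimes>\<^bsub>?G\<^esub> inv\<^bsub>?G\<^esub> a \<otimes>\<^bsub>?G\<^esub> a"
            using x a by (simp add: m_assoc del: mult_integer_mod_group inv_integer_mod_group)
          moreover have "x \<otimes>\<^bsub>?G\<^esub> inv\<^bsub>?G\<^esub> a \<in> H" unfolding HG' using x a(2) by (intro m_closed inv_closed)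
          ultimately show "x \<in> H <#>\<^bsub>?G\<^esub> A" using a unfolding in_set_mult_iff by blast
        qed
        then show False using proper set_mult_closed[OF HG A] by blast
      qed
      then have "H \<subset> carrier ?G" using HG by blast
      then have "h < n" using psubset_card_mono[OF finite_carrier, of H] unfolding h_def card_G by blast
      then have "d \<noteq> 1" using nd by auto
      then have "h * 2 \<le> h * d" using d by (intro mult_le_mono2) simp
      then have "2 * h \<le> n" using nd by simp
      have "H = {x \<in> {0..<int n}. x mod int d = 0}"
        using subgroup_eq_reduction_kernel(2)[OF less.prems(1) H] unfolding d_def h_def .
      then have ker: "kernel ?G (integer_mod_group d) (\<lambda>x. x mod int d) = H"
        unfolding reduction_hom(2)[OF less.prems(1) dn] by (rule sym)
      from sum_free_image_or_small[OF abelian_integer_mod_group reduction_hom(1)[OF less.prems(1) dn]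
          less.prems(2)] small ker
      have "sum_free_3_1 (integer_mod_group d) ((\<lambda>x. x mod int d) ` A) \<or> 2 * card A \<le> h"
        unfolding h_def ker by blast
      then show ?thesis
      proof
        let ?R = "(\<lambda>x. x mod int d) ` A"
        assume "sum_free_3_1 (integer_mod_group d) ?R"
        from less.IH[OF \<open>d < n\<close> d this] have IH: "card ?R \<le> interval_value d" .
        have "card A \<le> card {x \<in> {0..<int n}. x mod int d \<in> ?R}"
          using A unfolding cG
          by (intro card_mono finite_subset[of "{x \<in> {0..<int n}. x mod int d \<in> ?R}" "{0..<int n}"])
            auto
        also have "\<dots> = card ?R * (n div d)"
          using d by (intro card_residue_preimage[OF less.prems(1) dn]) auto
        also have "\<dots> \<le> interval_value d * (n div d)" using IH by simp
        also have "\<dots> \<le> interval_value n" by (rule interval_value_dvd[OF less.prems(1) dn])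
        finally show ?thesis .
      next
        assume "2 * card A \<le> h"
        with \<open>2 * h \<le> n\<close> have "card A \<le> n div 4" by linarith
        then show ?thesis using interval_value_ge_quarter[OF less.prems(1)] by linarith
      qed
    qed
  qed simp
qed

lemma sum_free_attaining_interval_value:
  assumes n: "n > 0"
  obtains A where "sum_free_3_1 (integer_mod_group n) A" "card A = interval_value n"
proof -
  obtain d where d: "d > 0" "d dvd n" "d mod 4 \<noteq> 2" "interval_value n = ((d + 2) div 4) * (n div d)"
    using interval_value_attained[OF n] .
  define k where "k = int ((d + 2) div 4)"
  define R where "R = {(k + 1) div 2..<(k + 1) div 2 + k}"
  have R: "R \<subseteq> {0..<int d}" "sum_free_3_1 (integer_mod_group d) R"
    unfolding R_def k_def using sum_free_interval[OF d(1,3)] by blast+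
  show thesis
  proof
    show "sum_free_3_1 (integer_mod_group n) {x \<in> {0..<int n}. x mod int d \<in> R}"
      by (rule sum_free_reduction_preimage[OF n d(2) R(2)])
    show "card {x \<in> {0..<int n}. x mod int d \<in> R} = interval_value n"
      unfolding card_residue_preimage[OF n d(2) R(1)] d(4) by (simp add: R_def k_def)
  qed
qed

lemma lambda_3_1_integer_mod_group:
  assumes n: "n > 0"
  shows "lambda_3_1 (integer_mod_group n) = interval_value n"
  unfolding lambda_3_1_def
proof (rule Max_eqI)
  show bound: "y \<le> interval_value n" if "y \<in> {card A |A. sum_free_3_1 (integer_mod_group n) A}" for y
    using that sum_free_card_le[OF n] by blast
  then show "finite {card A |A. sum_free_3_1 (integer_mod_group n) A}"
    by (meson atMost_iff finite_atMost finite_subset subsetI)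
  obtain A where "sum_free_3_1 (integer_mod_group n) A" "card A = interval_value n"
    using sum_free_attaining_interval_value[OF n] .
  then show "interval_value n \<in> {card A |A. sum_free_3_1 (integer_mod_group n) A}"
    by (intro CollectI exI[of _ A]) simp
qed

section \<open>The closed form\<close>

lemma prime_factor_3_mod_4:
  fixes d :: nat
  assumes "d mod 4 = 3"
  shows "\<exists>p. prime p \<and> p mod 4 = 3 \<and> p dvd d"
  using assms
proof (induction d rule: less_induct)
  case (less d)
  then obtain q where q: "prime q" "q dvd d" using prime_factor_nat[of d] by fastforce
  then obtain e where e: "d = q * e" by blast
  show ?case
  proof (cases "q mod 4 = 3")
    case False
    have "odd d" using less.prems by presburger
    then have "odd q" using e by simp
    then have q1: "q mod 4 = 1" using False by presburger
    have "d mod 4 = (q mod 4) * (e mod 4) mod 4" unfolding e by (simp add: mod_mult_eq)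
    then have e3: "e mod 4 = 3" using q1 less.prems by simp
    have "e < d" unfolding e
    proof (rule n_less_m_mult_n)
      show "0 < e" using e3 by (cases e) auto
    qed (use prime_gt_1_nat[OF q(1)] in simp)
    from less.IH[OF this e3] show ?thesis using e by auto
  qed (use q in blast)
qed

lemma four_times_interval_le:
  fixes d n :: nat
  assumes "d dvd n" "d mod 4 \<noteq> 2" "d mod 4 \<noteq> 3"
  shows "4 * (((d + 2) div 4) * (n div d)) \<le> n"
proof -
  have "4 * ((d + 2) div 4) \<le> d" using assms(2,3) by presburger
  then have "4 * ((d + 2) div 4) * (n div d) \<le> d * (n div d)" by (rule mult_le_mono1)
  then show ?thesis using assms(1) by (simp add: mult.assoc)
qed

lemma four_times_interval_3_mod_4:
  fixes d n :: nat
  assumes "d dvd n" "d mod 4 = 3"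
  shows "4 * (((d + 2) div 4) * (n div d)) = n + n div d"
proof -
  have "4 * ((d + 2) div 4) = d + 1" using assms(2) by presburger
  then have "4 * ((d + 2) div 4) * (n div d) = (d + 1) * (n div d)" by simp
  then show ?thesis using assms(1) by (simp add: mult.assoc)
qed

text \<open>
  Divisors \<open>d\<close> with \<open>d mod 4 \<in> {0, 1}\<close> contribute at most \<open>n / 4\<close>, and those with \<open>d mod 4 = 3\<close> contribute
  \<open>(n + n / d) / 4\<close>. Each of the latter has a prime factor that is \<open>3\<close> modulo \<open>4\<close>, so the least such prime
  is the least of them.
\<close>

lemma interval_value_eq_prime:
  assumes n: "n > 0" and p: "p mod 4 = 3" "p dvd n"
    and least: "\<And>q. prime q \<Longrightarrow> q mod 4 = 3 \<Longrightarrow> q dvd n \<Longrightarrow> p \<le> q"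
  shows "4 * interval_value n = n + n div p"
proof (rule antisym)
  show "n + n div p \<le> 4 * interval_value n"
    using interval_value_ge[OF n p(2)] four_times_interval_3_mod_4[OF p(2,1)] p(1) by simp
  obtain d where d: "d > 0" "d dvd n" "d mod 4 \<noteq> 2" "interval_value n = ((d + 2) div 4) * (n div d)"
    using interval_value_attained[OF n] .
  show "4 * interval_value n \<le> n + n div p"
  proof (cases "d mod 4 = 3")
    case True
    then obtain q where q: "prime q" "q mod 4 = 3" "q dvd d" using prime_factor_3_mod_4 by blast
    then have "p \<le> q" using least d(2) dvd_trans by blast
    also have "q \<le> d" using q(3) d(1) by (rule dvd_imp_le)
    finally have "n div d \<le> n div p" using p(1) by (intro div_le_mono2) (auto intro: Nat.gr0I)
    then show ?thesis using four_times_interval_3_mod_4[OF d(2) True] d(4) by simp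
  next
    case False
    then show ?thesis using four_times_interval_le[OF d(2,3)] d(4) by simp
  qed
qed

lemma interval_value_eq_quarter:
  assumes n: "n > 0" and no_prime: "\<nexists>p. prime p \<and> p mod 4 = 3 \<and> p dvd n"
  shows "interval_value n = n div 4"
proof (rule antisym[OF _ interval_value_ge_quarter[OF n]])
  obtain d where d: "d > 0" "d dvd n" "d mod 4 \<noteq> 2" "interval_value n = ((d + 2) div 4) * (n div d)"
    using interval_value_attained[OF n] .
  have "d mod 4 \<noteq> 3" using prime_factor_3_mod_4 no_prime d(2) dvd_trans by blast
  then show "interval_value n \<le> n div 4" using four_times_interval_le[OF d(2,3)] d(4) by linarith
qed

theorem theorem6:
  fixes n :: nat
  assumes "n > 1"
  shows "lambda_3_1 (integer_mod_group n) =
           Max {((d + 2) div 4) * (n div d) | d :: nat. d > 0 \<and> d dvd n \<and> [d \<noteq> 2] (mod 4)}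
    \<and> (\<forall>p :: nat.
          prime p \<and> [p = 3] (mod 4) \<and> p dvd n \<and>
          (\<forall>q. prime q \<and> [q = 3] (mod 4) \<and> q dvd n \<longrightarrow> p \<le> q) \<longrightarrow>
          real (lambda_3_1 (integer_mod_group n)) = (real p + 1) / real p * (real n / 4))
    \<and> ((\<nexists>p :: nat. prime p \<and> [p = 3] (mod 4) \<and> p dvd n) \<longrightarrow>
          lambda_3_1 (integer_mod_group n) = n div 4)"
proof (intro conjI allI impI)
  have n: "n > 0" using assms by simp
  have mod3: "[q = 3] (mod 4) \<longleftrightarrow> q mod 4 = 3" for q :: nat by (simp add: cong_def)
  note lam = lambda_3_1_integer_mod_group[OF n]
  show "lambda_3_1 (integer_mod_group n) =
    Max {((d + 2) div 4) * (n div d) | d :: nat. d > 0 \<and> d dvd n \<and> [d \<noteq> 2] (mod 4)}"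
    unfolding lam interval_value_def ..
  show "real (lambda_3_1 (integer_mod_group n)) = (real p + 1) / real p * (real n / 4)"
    if "prime p \<and> [p = 3] (mod 4) \<and> p dvd n \<and>
          (\<forall>q. prime q \<and> [q = 3] (mod 4) \<and> q dvd n \<longrightarrow> p \<le> q)" for p
  proof -
    have p: "p mod 4 = 3" "p dvd n" and least: "\<And>q. prime q \<Longrightarrow> q mod 4 = 3 \<Longrightarrow> q dvd n \<Longrightarrow> p \<le> q"
      and "p > 0" using that by (auto simp: mod3 prime_gt_0_nat)
    have "4 * real (interval_value n) = real n + real (n div p)"
      using interval_value_eq_prime[OF n p least] by linarith
    also have "real (n div p) = real n / real p" using p(2) by (rule real_of_nat_div)
    finally show ?thesis unfolding lam using \<open>p > 0\<close> by (simp add: field_simps)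
  qed
  show "lambda_3_1 (integer_mod_group n) = n div 4"
    if "\<nexists>p :: nat. prime p \<and> [p = 3] (mod 4) \<and> p dvd n"
    unfolding lam by (rule interval_value_eq_quarter[OF n]) (use that in \<open>simp add: mod3\<close>)
qed

end
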